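(* If $Q$ is a basic sequence that is infinite in limit and $1$-convergent, then $\lambda(\mathscr{RN}_1(Q))=0$, where $\lambda$ is Lebesgue measure on $\mathbb R$.
   Context: A basic sequence is a sequence $Q=(q_n)_{n=1}^\infty$ of integers $q_n\ge 2$. It is infinite in limit if $q_n\to\infty$, and $1$-convergent if $\sum_{n=1}^\infty 1/q_n<\infty$. The $Q$-Cantor series expansion of $x\in\mathbb R$ is the unique expansion $x=\lfloor x\rfloor+\sum_{n=1}^\infty \frac{E_n}{q_1q_2\cdots q_n}$ with $E_n\in\{0,1,\dots,q_n-1\}$ for $n\ge1$ and $E_n\ne q_n-1$ for infinitely many $n$. For a block (finite sequence) $B$ of non-negative integers, $N_n^Q(B,x)$ is the number of times $B$ occurs in the digit sequence $(E_1,E_2,\dots)$ of $x$ starting at a position no greater than $n$. $\mathscr{RN}_1(Q)$ is the set of real $x$ such that for all blocks $B_1,B_2$ of length $1$, $\lim_{n\to\infty} N_n^Q(B_1,x)/N_n^Q(B_2,x)=1$. *)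

theory Defs
  imports "HOL-Analysis.Analysis"
begin

text \<open>Basic sequences and digit sequences are indexed from 1; the value of a basic sequence at 0
  is never used.\<close>

definition basic_sequence :: "(nat \<Rightarrow> nat) \<Rightarrow> bool" where
  "basic_sequence q \<longleftrightarrow> (\<forall>n\<ge>1. q n \<ge> 2)"

definition infinite_in_limit :: "(nat \<Rightarrow> nat) \<Rightarrow> bool" where
  "infinite_in_limit q \<longleftrightarrow> filterlim q at_top sequentially"

definition one_convergent :: "(nat \<Rightarrow> nat) \<Rightarrow> bool" where
  "one_convergent q \<longleftrightarrow> summable (\<lambda>n. 1 / real (q (Suc n)))"

text \<open>The series is reindexed by \<open>n \<mapsto> Suc n\<close>, as \<open>sums\<close> starts at 0.\<close>

definition is_cantor_expansion :: "(nat \<Rightarrow> nat) \<Rightarrow> real \<Rightarrow> (nat \<Rightarrow> nat) \<Rightarrow> bool" where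
  "is_cantor_expansion q x E \<longleftrightarrow>
     (\<forall>n\<ge>1. E n \<in> {0..q n - 1}) \<and>
     infinite {n. n \<ge> 1 \<and> E n \<noteq> q n - 1} \<and>
     (\<lambda>n. real (E (Suc n)) / (\<Prod>i=1..Suc n. real (q i))) sums (x - of_int \<lfloor>x\<rfloor>)"

text \<open>The expansion does not constrain \<open>E 0\<close>; fixing it to 0 makes the function \<open>E\<close> unique.\<close>

definition cantor_digits :: "(nat \<Rightarrow> nat) \<Rightarrow> real \<Rightarrow> nat \<Rightarrow> nat" where
  "cantor_digits q x = (THE E. E 0 = 0 \<and> is_cantor_expansion q x E)"

definition block_count :: "(nat \<Rightarrow> nat) \<Rightarrow> nat \<Rightarrow> nat list \<Rightarrow> real \<Rightarrow> nat" where
  "block_count q n B x =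
     card {i. 1 \<le> i \<and> i \<le> n \<and> (\<forall>j<length B. cantor_digits q x (i + j) = B ! j)}"

text \<open>If \<open>B2\<close> never occurs, the quotient is constantly 0 by the convention \<open>a / 0 = 0\<close>, so the limit
  is not 1 and \<open>x\<close> is excluded; otherwise only finitely many quotients have denominator 0.\<close>

definition RN1 :: "(nat \<Rightarrow> nat) \<Rightarrow> real set" where
  "RN1 q = {x. \<forall>B1 B2. length B1 = 1 \<and> length B2 = 1 \<longrightarrow>
     (\<lambda>n. real (block_count q n B1 x) / real (block_count q n B2 x)) \<longlonglongrightarrow> 1}"

end

theory Submission
  imports Defs
begin

text \<open>
  If \<open>x\<close> lies in \<open>RN1 q\<close>, then every natural number \<open>d\<close> occurs among the digits of \<open>x\<close>, since
  otherwise the quotient with \<open>B1 = B2 = [d]\<close> is constantly 0. The digit at position \<open>n\<close> equals \<open>d\<close>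
  on a subset of a unit interval of measure at most \<open>1 / q n\<close>, and on the empty set if \<open>d \<ge> q n\<close>. So
  if \<open>d\<close> is at least as large as \<open>q 1, \<dots>, q N\<close>, it occurs with probability at most the tail
  \<open>\<Sum>n>N. 1 / q n\<close>, which tends to 0 as \<open>N\<close> grows.
\<close>

section \<open>Products of the bases and their growth\<close>

definition base_prod :: "(nat \<Rightarrow> nat) \<Rightarrow> nat \<Rightarrow> nat" where
  "base_prod q n = (\<Prod>i=1..n. q i)"

lemma base_prod_0 [simp]: "base_prod q 0 = 1"
  by (simp add: base_prod_def)

lemma base_prod_Suc: "base_prod q (Suc n) = base_prod q n * q (Suc n)"
  by (simp add: base_prod_def)

lemma real_base_prod: "real (base_prod q n) = (\<Prod>i=1..n. real (q i))"
  by (simp add: base_prod_def)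

lemma power2_le_base_prod:
  assumes "basic_sequence q"
  shows "2 ^ n \<le> base_prod q n"
proof (induction n)
  case (Suc n)
  have "2 \<le> q (Suc n)"
    using assms by (simp add: basic_sequence_def)
  then have "2 ^ n * 2 \<le> base_prod q n * q (Suc n)"
    using Suc by (intro mult_le_mono)
  then show ?case
    by (simp add: base_prod_Suc mult.commute)
qed simp

lemma base_prod_pos:
  assumes "basic_sequence q"
  shows "0 < base_prod q n"
  by (rule less_le_trans[OF _ power2_le_base_prod[OF assms, of n]]) simp

lemma inverse_base_prod_tendsto_0:
  assumes "basic_sequence q"
  shows "(\<lambda>n. 1 / real (base_prod q n)) \<longlonglongrightarrow> 0"
proof (rule tendsto_sandwich[of "\<lambda>_. 0" _ _ "\<lambda>n. (1 / 2) ^ n"])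
  have "1 / real (base_prod q n) \<le> (1 / 2) ^ n" for n
  proof -
    have "real (2 ^ n) \<le> real (base_prod q n)"
      using power2_le_base_prod[OF assms] of_nat_le_iff by blast
    then show ?thesis
      by (simp add: power_one_over frac_le)
  qed
  then show "\<forall>\<^sub>F n in sequentially. 1 / real (base_prod q n) \<le> (1 / 2) ^ n"
    by simp
qed (simp_all add: LIMSEQ_realpow_zero)

section \<open>Digits read off from floors\<close>

text \<open>The numerator of the \<open>n\<close>-th partial sum of the expansion of \<open>x\<close> over the denominator
  \<open>base_prod q n\<close>.\<close>

definition cantor_numerator :: "(nat \<Rightarrow> nat) \<Rightarrow> real \<Rightarrow> nat \<Rightarrow> int" where
  "cantor_numerator q x n = \<lfloor>real (base_prod q n) * frac x\<rfloor>"

lemma cantor_numerator_0 [simp]: "cantor_numerator q x 0 = 0"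
  by (simp add: cantor_numerator_def floor_eq_iff frac_lt_1)

text \<open>Multiply \<open>\<lfloor>t\<rfloor> \<le> t < \<lfloor>t\<rfloor> + 1\<close> by
  \<open>q (Suc n)\<close>. The two bounds place the next digit between 0 and
  \<open>q (Suc n) - 1\<close>.\<close>

lemma cantor_numerator_step:
  assumes "basic_sequence q"
  shows "int (q (Suc n)) * cantor_numerator q x n \<le> cantor_numerator q x (Suc n)"
    and "cantor_numerator q x (Suc n) < int (q (Suc n)) * (cantor_numerator q x n + 1)"
proof -
  define t where "t = real (base_prod q n) * frac x"
  define b where "b = real (q (Suc n))"
  have b: "b > 0"
    using assms by (auto simp: basic_sequence_def b_def dest!: spec[of _ "Suc n"])
  have t: "real (base_prod q (Suc n)) * frac x = b * t"
    by (simp add: t_def b_def base_prod_Suc)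
  have "b * of_int \<lfloor>t\<rfloor> \<le> b * t"
    using b by simp
  then show "int (q (Suc n)) * cantor_numerator q x n \<le> cantor_numerator q x (Suc n)"
    unfolding cantor_numerator_def t by (simp add: le_floor_iff b_def t_def)
  have "b * t < b * (of_int \<lfloor>t\<rfloor> + 1)"
    using b by simp
  then show "cantor_numerator q x (Suc n) < int (q (Suc n)) * (cantor_numerator q x n + 1)"
    unfolding cantor_numerator_def t by (simp add: floor_less_iff b_def t_def)
qed

text \<open>The value at 0 matches the normalisation in \<open>cantor_digits\<close>. For a basic
  sequence \<open>nat\<close> truncates nothing, by \<open>cantor_numerator_step\<close>.\<close>

definition floor_digit :: "(nat \<Rightarrow> nat) \<Rightarrow> real \<Rightarrow> nat \<Rightarrow> nat" where
  "floor_digit q x n =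
     (case n of 0 \<Rightarrow> 0
      | Suc m \<Rightarrow> nat (cantor_numerator q x (Suc m) - int (q (Suc m)) * cantor_numerator q x m))"

lemma int_floor_digit:
  assumes "basic_sequence q"
  shows "int (floor_digit q x (Suc n)) =
    cantor_numerator q x (Suc n) - int (q (Suc n)) * cantor_numerator q x n"
  using cantor_numerator_step(1)[OF assms, of n x] by (simp add: floor_digit_def)

lemma floor_digit_less:
  assumes "basic_sequence q"
  shows "floor_digit q x (Suc n) < q (Suc n)"
  using cantor_numerator_step(2)[OF assms, of x n] int_floor_digit[OF assms, of x n]
  by (simp add: algebra_simps)

section \<open>Existence and uniqueness of the expansion\<close>

text \<open>Horner's scheme. The sequence \<open>S\<close> is left abstract so as to cover both the
  floor numerators (existence) and the numerators of a given expansion (uniqueness).\<close>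

lemma sum_digits_eq_numerator:
  fixes S :: "nat \<Rightarrow> int"
  assumes "basic_sequence q" "S 0 = 0"
    and step: "\<And>n. S (Suc n) = int (q (Suc n)) * S n + int (E (Suc n))"
  shows "(\<Sum>k<n. real (E (Suc k)) / real (base_prod q (Suc k))) = of_int (S n) / real (base_prod q n)"
proof (induction n)
  case 0
  then show ?case using assms by simp
next
  case (Suc n)
  have "q (Suc n) \<noteq> 0" "base_prod q n \<noteq> 0"
    using assms(1) base_prod_pos[OF assms(1), of n]
    by (auto simp: basic_sequence_def dest!: spec[of _ "Suc n"])
  with Suc show ?case
    by (simp add: step base_prod_Suc field_simps)
qed

lemma cantor_numerator_tendsto:
  assumes "basic_sequence q"
  shows "(\<lambda>n. of_int (cantor_numerator q x n) / real (base_prod q n)) \<longlonglongrightarrow> frac x"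
proof (rule LIMSEQ_I)
  fix e :: real
  assume "e > 0"
  then obtain N where N: "\<And>n. n \<ge> N \<Longrightarrow> 1 / real (base_prod q n) < e"
    using LIMSEQ_D[OF inverse_base_prod_tendsto_0[OF assms]] by fastforce
  have "norm (of_int (cantor_numerator q x n) / real (base_prod q n) - frac x) < e"
    if "n \<ge> N" for n
  proof -
    let ?b = "real (base_prod q n)"
    have b: "?b > 0"
      using base_prod_pos[OF assms] by simp
    have "of_int (cantor_numerator q x n) \<le> ?b * frac x"
      "?b * frac x < of_int (cantor_numerator q x n) + 1"
      by (simp_all add: cantor_numerator_def)
    then have "of_int (cantor_numerator q x n) / ?b \<le> frac x"
      "frac x \<le> of_int (cantor_numerator q x n) / ?b + 1 / ?b"
      using b by (simp_all add: pos_divide_le_eq pos_le_divide_eq mult.commute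
          flip: add_divide_distrib)
    then have "\<bar>of_int (cantor_numerator q x n) / ?b - frac x\<bar> \<le> 1 / ?b"
      by linarith
    then show ?thesis
      using N[OF that] by simp
  qed
  then show "\<exists>N. \<forall>n\<ge>N. norm (of_int (cantor_numerator q x n) / real (base_prod q n) - frac x) < e"
    by blast
qed

lemma is_cantor_expansion_floor_digit:
  assumes "basic_sequence q"
  shows "is_cantor_expansion q x (floor_digit q x)"
proof -
  let ?A = "cantor_numerator q x" and ?P = "\<lambda>n. real (base_prod q n)"
  have digits: "\<forall>n\<ge>1. floor_digit q x n \<in> {0..q n - 1}"
  proof (intro allI impI)
    fix n :: nat
    assume "n \<ge> 1"
    then show "floor_digit q x n \<in> {0..q n - 1}"
      using floor_digit_less[OF assms, of x "n - 1"] by simp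
  qed
  have "(\<Sum>k<n. real (floor_digit q x (Suc k)) / ?P (Suc k)) = of_int (?A n) / ?P n" for n
    by (rule sum_digits_eq_numerator) (simp_all add: assms int_floor_digit)
  then have "(\<lambda>n. real (floor_digit q x (Suc n)) / ?P (Suc n)) sums frac x"
    using cantor_numerator_tendsto[OF assms, of x] by (simp add: sums_def)
  then have series: "(\<lambda>n. real (floor_digit q x (Suc n)) / (\<Prod>i=1..Suc n. real (q i)))
      sums (x - of_int \<lfloor>x\<rfloor>)"
    by (simp only: real_base_prod frac_def)
  have "infinite {n. n \<ge> 1 \<and> floor_digit q x n \<noteq> q n - 1}"
  proof
    assume "finite {n. n \<ge> 1 \<and> floor_digit q x n \<noteq> q n - 1}"
    then obtain N where N: "\<And>n. n \<ge> 1 \<Longrightarrow> floor_digit q x n \<noteq> q n - 1 \<Longrightarrow> n \<le> N"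
      by (auto simp: finite_nat_set_iff_bounded_le)
    \<comment> \<open>Digits that are maximal from \<open>N\<close> on make the upper ends of the floor cells stationary.\<close>
    have const: "(of_int (?A (N + k)) + 1) / ?P (N + k) = (of_int (?A N) + 1) / ?P N" for k
    proof (induction k)
      case (Suc k)
      let ?n = "N + k"
      have q2: "q (Suc ?n) \<ge> 2"
        using assms by (simp add: basic_sequence_def)
      have "floor_digit q x (Suc ?n) = q (Suc ?n) - 1"
        using N[of "Suc ?n"] by fastforce
      then have "?A (Suc ?n) + 1 = int (q (Suc ?n)) * (?A ?n + 1)"
        using int_floor_digit[OF assms, of x ?n] q2 by (simp add: algebra_simps)
      then have "of_int (?A (Suc ?n)) + 1 = real (q (Suc ?n)) * (of_int (?A ?n) + 1)"
        by (metis of_int_1 of_int_add of_int_mult of_int_of_nat_eq)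
      then show ?case
        using Suc q2 by (simp add: base_prod_Suc)
    qed simp
    have "(\<lambda>n. of_int (?A n) / ?P n + 1 / ?P n) \<longlonglongrightarrow> frac x + 0"
      by (intro tendsto_add cantor_numerator_tendsto inverse_base_prod_tendsto_0 assms)
    then have "(\<lambda>n. (of_int (?A n) + 1) / ?P n) \<longlonglongrightarrow> frac x"
      by (simp add: add_divide_distrib)
    then have "(\<lambda>k. (of_int (?A (N + k)) + 1) / ?P (N + k)) \<longlonglongrightarrow> frac x"
      using LIMSEQ_ignore_initial_segment[of _ "frac x" N] by (simp add: add.commute)
    \<comment> \<open>A constant sequence equals its limit, so \<open>frac x\<close> would be the
      upper end of its own floor cell, which is half-open.\<close>
    then have "(of_int (?A N) + 1) / ?P N = frac x"
      unfolding const by (simp add: LIMSEQ_const_iff)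
    then have "of_int (?A N) + 1 = ?P N * frac x"
      using base_prod_pos[OF assms, of N] by (simp add: field_simps)
    then show False
      unfolding cantor_numerator_def by linarith
  qed
  with digits series show ?thesis
    by (simp add: is_cantor_expansion_def)
qed

text \<open>The partial sums increase to \<open>frac x\<close>, while the upper ends
  \<open>(S n + 1) / base_prod q n\<close> decrease to it. If the upper bound is strict,
  \<open>S n\<close> must be the floor numerator, and the numerators determine the digits.\<close>

lemma is_cantor_expansion_unique:
  assumes "basic_sequence q" and E: "is_cantor_expansion q x E" and "E 0 = 0"
  shows "E = floor_digit q x"
proof -
  let ?P = "\<lambda>n. real (base_prod q n)"
  define S :: "nat \<Rightarrow> int" where
    "S = rec_nat 0 (\<lambda>n s. int (q (Suc n)) * s + int (E (Suc n)))"
  have S0: "S 0 = 0" and step: "\<And>n. S (Suc n) = int (q (Suc n)) * S n + int (E (Suc n))"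
    by (simp_all add: S_def)
  have P: "?P n > 0" for n
    using base_prod_pos[OF assms(1)] by simp
  have q2: "q (Suc n) \<ge> 2" for n
    using assms by (simp add: basic_sequence_def)
  have E_less: "E (Suc n) + 1 \<le> q (Suc n)" for n
  proof -
    have "E (Suc n) \<le> q (Suc n) - 1"
      using E by (simp add: is_cantor_expansion_def)
    then show ?thesis
      using q2[of n] by linarith
  qed
  have sums: "(\<lambda>n. real (E (Suc n)) / ?P (Suc n)) sums frac x"
    using E unfolding is_cantor_expansion_def by (simp only: real_base_prod frac_def)
  have partial: "(\<Sum>k<n. real (E (Suc k)) / ?P (Suc k)) = of_int (S n) / ?P n" for n
    by (rule sum_digits_eq_numerator) (simp_all add: assms S0 step)
  have lim: "(\<lambda>n. of_int (S n) / ?P n) \<longlonglongrightarrow> frac x"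
    using sums by (simp add: sums_def partial)
  have "(\<lambda>n. of_int (S n) / ?P n + 1 / ?P n) \<longlonglongrightarrow> frac x + 0"
    by (intro tendsto_add lim inverse_base_prod_tendsto_0 assms)
  then have upper_lim: "(\<lambda>n. (of_int (S n) + 1) / ?P n) \<longlonglongrightarrow> frac x"
    by (simp add: add_divide_distrib)
  \<comment> \<open>The upper end drops by the distance of the digit from its maximum, in units of
    \<open>1 / ?P (Suc n)\<close>.\<close>
  have shift: "(of_int (S (Suc n)) + 1) / ?P (Suc n) =
      (of_int (S n) + 1) / ?P n - (real (q (Suc n)) - real (E (Suc n)) - 1) / ?P (Suc n)" for n
    using P[of n] q2[of n] by (simp add: step base_prod_Suc field_simps)
  have dec: "decseq (\<lambda>n. (of_int (S n) + 1) / ?P n)"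
  proof (rule decseq_SucI)
    fix n
    have "(real (q (Suc n)) - real (E (Suc n)) - 1) / ?P (Suc n) \<ge> 0"
      using E_less[of n] by (intro divide_nonneg_nonneg) linarith+
    then show "(of_int (S (Suc n)) + 1) / ?P (Suc n) \<le> (of_int (S n) + 1) / ?P n"
      unfolding shift by linarith
  qed
  have floor_eq: "S n = cantor_numerator q x n" for n
  proof -
    have "incseq (\<lambda>n. of_int (S n) / ?P n)"
      unfolding partial[symmetric] by (rule incseq_SucI) (simp add: P less_imp_le)
    then have "of_int (S n) / ?P n \<le> frac x"
      using incseq_le lim by blast
    then have lower: "of_int (S n) \<le> ?P n * frac x"
      using P[of n] by (simp add: field_simps)
    \<comment> \<open>A non-maximal digit after position \<open>n\<close> makes the upper bound
      strict; this is what rules out a tail of maximal digits.\<close>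
    have "infinite {n. n \<ge> 1 \<and> E n \<noteq> q n - 1}"
      using E by (simp add: is_cantor_expansion_def)
    then obtain m' where m': "m' > n" "E m' \<noteq> q m' - 1"
      unfolding infinite_nat_iff_unbounded by blast
    then obtain m where m: "m \<ge> n" "E (Suc m) \<noteq> q (Suc m) - 1"
      by (metis Suc_le_D Suc_le_mono Suc_leI)
    have "(real (q (Suc m)) - real (E (Suc m)) - 1) / ?P (Suc m) > 0"
      using E_less[of m] m(2) q2[of m] P[of "Suc m"] by (intro divide_pos_pos) linarith+
    then have "(of_int (S (Suc m)) + 1) / ?P (Suc m) < (of_int (S m) + 1) / ?P m"
      unfolding shift by linarith
    moreover have "frac x \<le> (of_int (S (Suc m)) + 1) / ?P (Suc m)"
      using decseq_ge[OF dec upper_lim] .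
    moreover have "(of_int (S m) + 1) / ?P m \<le> (of_int (S n) + 1) / ?P n"
      using dec m(1) by (rule decseqD)
    ultimately have "frac x < (of_int (S n) + 1) / ?P n"
      by linarith
    then have "?P n * frac x < of_int (S n) + 1"
      using P[of n] by (simp add: field_simps)
    with lower show ?thesis
      unfolding cantor_numerator_def by linarith
  qed
  have "E n = floor_digit q x n" for n
  proof (cases n)
    case 0
    then show ?thesis
      using assms(3) by (simp add: floor_digit_def)
  next
    case (Suc m)
    then show ?thesis
      using step[of m] int_floor_digit[OF assms(1), of x m] by (simp add: floor_eq)
  qed
  then show ?thesis
    by blast
qed

text \<open>Existence and uniqueness evaluate the definite description, so that the explicit floor
  formula can replace it from here on.\<close>

lemma cantor_digits_eq_floor_digit:
  assumes "basic_sequence q"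
  shows "cantor_digits q x = floor_digit q x"
  unfolding cantor_digits_def
proof (rule the_equality)
  show "floor_digit q x 0 = 0 \<and> is_cantor_expansion q x (floor_digit q x)"
    using is_cantor_expansion_floor_digit[OF assms] by (simp add: floor_digit_def)
qed (use is_cantor_expansion_unique[OF assms] in blast)

section \<open>Measure of the points with a prescribed digit\<close>

text \<open>A cover of the points with integer part \<open>k\<close> and digit \<open>d\<close> at
  position \<open>Suc n\<close>; \<open>j\<close> runs over the possible numerators at
  \<open>n\<close>. Closing the intervals adds no measure.\<close>

definition digit_cells :: "(nat \<Rightarrow> nat) \<Rightarrow> int \<Rightarrow> nat \<Rightarrow> nat \<Rightarrow> real set" where
  "digit_cells q k n d = (\<Union>j<base_prod q n.
     {of_int k + real (j * q (Suc n) + d) / real (base_prod q (Suc n))..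
      of_int k + (real (j * q (Suc n) + d) + 1) / real (base_prod q (Suc n))})"

lemma digit_cells_borel [measurable, simp]: "digit_cells q k n d \<in> sets borel"
  by (simp add: digit_cells_def)

text \<open>There are \<open>base_prod q n\<close> intervals, each of length
  \<open>1 / base_prod q (Suc n)\<close>. A union bound suffices, uniformly in
  \<open>d\<close>.\<close>

lemma emeasure_digit_cells_le:
  assumes "basic_sequence q"
  shows "emeasure lborel (digit_cells q k n d) \<le> ennreal (1 / real (q (Suc n)))"
proof -
  let ?P = "\<lambda>n. real (base_prod q n)"
  have P: "?P n > 0" for n
    using base_prod_pos[OF assms] by simp
  have "emeasure lborel (digit_cells q k n d) \<le> (\<Sum>j<base_prod q n. emeasure lborel
     {of_int k + real (j * q (Suc n) + d) / ?P (Suc n)..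
      of_int k + (real (j * q (Suc n) + d) + 1) / ?P (Suc n)})"
    unfolding digit_cells_def by (rule emeasure_subadditive_finite) auto
  also have "\<dots> = (\<Sum>j<base_prod q n. ennreal (1 / ?P (Suc n)))"
  proof (rule sum.cong[OF refl])
    fix j
    show "emeasure lborel {of_int k + real (j * q (Suc n) + d) / ?P (Suc n)..
      of_int k + (real (j * q (Suc n) + d) + 1) / ?P (Suc n)} = ennreal (1 / ?P (Suc n))"
      using P[of "Suc n"] by (subst emeasure_lborel_Icc) (auto simp: divide_simps)
  qed
  also have "\<dots> = ennreal (?P n * (1 / ?P (Suc n)))"
    by (subst ennreal_mult) (simp_all add: ennreal_of_nat_eq_real_of_nat)
  also have "?P n * (1 / ?P (Suc n)) = 1 / real (q (Suc n))"
    using P[of n] by (simp add: base_prod_Suc)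
  finally show ?thesis .
qed

lemma mem_digit_cells:
  assumes "basic_sequence q"
  shows "x \<in> digit_cells q \<lfloor>x\<rfloor> n (floor_digit q x (Suc n))"
proof -
  let ?A = "cantor_numerator q x" and ?P = "\<lambda>n. real (base_prod q n)"
  \<comment> \<open>The numerator at \<open>Suc n\<close> is \<open>q (Suc n)\<close> times the one
    at \<open>n\<close> plus the digit, so the latter numerator indexes the cell.\<close>
  define j where "j = nat (?A n)"
  have P: "?P n > 0" for n
    using base_prod_pos[OF assms] by simp
  have "?A n \<ge> 0"
    by (simp add: cantor_numerator_def)
  then have j: "int j = ?A n"
    by (simp add: j_def)
  have "?P n * frac x < ?P n"
    using P[of n] frac_lt_1[of x] by simp
  then have "?A n < int (base_prod q n)"
    by (simp add: cantor_numerator_def floor_less_iff)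
  then have "j < base_prod q n"
    using j by simp
  moreover have "int (j * q (Suc n) + floor_digit q x (Suc n)) = ?A (Suc n)"
    by (simp add: int_floor_digit[OF assms] j)
  then have A: "real (j * q (Suc n) + floor_digit q x (Suc n)) = of_int (?A (Suc n))"
    by (metis of_int_of_nat_eq)
  have "of_int (?A (Suc n)) \<le> ?P (Suc n) * frac x" "?P (Suc n) * frac x \<le> of_int (?A (Suc n)) + 1"
    unfolding cantor_numerator_def by linarith+
  then have "of_int (?A (Suc n)) / ?P (Suc n) \<le> frac x" "frac x \<le> (of_int (?A (Suc n)) + 1) / ?P (Suc n)"
    using P[of "Suc n"] by (simp_all add: field_simps)
  then have "x \<in> {of_int \<lfloor>x\<rfloor> + real (j * q (Suc n) + floor_digit q x (Suc n)) / ?P (Suc n)..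
      of_int \<lfloor>x\<rfloor> + (real (j * q (Suc n) + floor_digit q x (Suc n)) + 1) / ?P (Suc n)}"
    unfolding A by (simp add: frac_def algebra_simps)
  ultimately show ?thesis
    unfolding digit_cells_def by blast
qed

section \<open>Covering \<open>RN1 q\<close> by null sets\<close>

lemma RN1_every_digit_occurs:
  assumes "basic_sequence q" "x \<in> RN1 q"
  obtains n where "floor_digit q x (Suc n) = d"
proof -
  have lim: "(\<lambda>n. real (block_count q n [d] x) / real (block_count q n [d] x)) \<longlonglongrightarrow> 1"
    using assms(2) unfolding RN1_def mem_Collect_eq by (elim allE[of _ "[d]"]) simp
  have "\<exists>n. block_count q n [d] x \<noteq> 0"
  proof (rule ccontr)
    assume "\<not> (\<exists>n. block_count q n [d] x \<noteq> 0)"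
    with lim show False
      by (simp add: LIMSEQ_const_iff)
  qed
  then obtain n where "card {i. 1 \<le> i \<and> i \<le> n \<and> cantor_digits q x i = d} \<noteq> 0"
    by (auto simp: block_count_def)
  then have "{i. 1 \<le> i \<and> i \<le> n \<and> cantor_digits q x i = d} \<noteq> {}"
    by (metis card.empty)
  then obtain i where "1 \<le> i" "floor_digit q x i = d"
    using cantor_digits_eq_floor_digit[OF assms(1)] by auto
  then show thesis
    using that[of "i - 1"] by simp
qed

text \<open>The digit \<open>\<Sum>i\<le>N. q i\<close> is too large to occur at the positions \<open>1, \<dots>, N\<close>.\<close>

definition late_cells :: "(nat \<Rightarrow> nat) \<Rightarrow> int \<Rightarrow> nat \<Rightarrow> real set" where
  "late_cells q k N = (\<Union>n. digit_cells q k (n + N) (\<Sum>i\<le>N. q i))"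

lemma late_cells_borel [measurable, simp]: "late_cells q k N \<in> sets borel"
  unfolding late_cells_def by measurable

lemma RN1_subset_late_cells:
  assumes "basic_sequence q" "x \<in> RN1 q"
  shows "x \<in> late_cells q \<lfloor>x\<rfloor> N"
proof -
  obtain n where n: "floor_digit q x (Suc n) = (\<Sum>i\<le>N. q i)"
    using RN1_every_digit_occurs[OF assms] .
  have "n \<ge> N"
  proof (rule ccontr)
    assume "\<not> n \<ge> N"
    then have "q (Suc n) \<le> (\<Sum>i\<le>N. q i)"
      by (intro member_le_sum) auto
    then show False
      using floor_digit_less[OF assms(1), of x n] n by simp
  qed
  then show ?thesis
    using mem_digit_cells[OF assms(1), of x n] unfolding late_cells_def n
    by (auto intro!: exI[of _ "n - N"])
qed

text \<open>A Borel-Cantelli type estimate in which the digit varies with \<open>N\<close>: the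
  bound on each cell does not depend on the digit, so each \<open>late_cells q k N\<close> is
  controlled by a tail of the same convergent series.\<close>

lemma late_cells_Inter_null:
  assumes "basic_sequence q" "one_convergent q"
  shows "(\<Inter>N. late_cells q k N) \<in> null_sets lborel"
proof -
  define f where "f = (\<lambda>n. 1 / real (q (Suc n)))"
  have f: "summable f" "\<And>n. f n \<ge> 0"
    using assms(2) by (auto simp: one_convergent_def f_def)
  have bound: "emeasure lborel (\<Inter>N. late_cells q k N) \<le> ennreal (\<Sum>n. f (n + N))" for N
  proof -
    have "emeasure lborel (\<Inter>N. late_cells q k N) \<le> emeasure lborel (late_cells q k N)"
      by (rule emeasure_mono) auto
    also have "\<dots> \<le> (\<Sum>n. emeasure lborel (digit_cells q k (n + N) (\<Sum>i\<le>N. q i)))"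
      unfolding late_cells_def by (rule emeasure_subadditive_countably) auto
    also have "\<dots> \<le> (\<Sum>n. ennreal (f (n + N)))"
      unfolding f_def by (intro suminf_le emeasure_digit_cells_le assms) auto
    also have "\<dots> = ennreal (\<Sum>n. f (n + N))"
      using f by (intro suminf_ennreal2) auto
    finally show ?thesis .
  qed
  have "(\<lambda>N. \<Sum>n. f (n + N)) \<longlonglongrightarrow> 0"
    by (rule suminf_exist_split2[OF f(1)])
  then have "(\<lambda>N. ennreal (\<Sum>n. f (n + N))) \<longlonglongrightarrow> ennreal 0"
    by (rule tendsto_ennrealI)
  \<comment> \<open>The measure on the left is fixed and lies below every term of a sequence tending
    to 0.\<close>
  then have "emeasure lborel (\<Inter>N. late_cells q k N) \<le> ennreal 0"
    by (rule LIMSEQ_le_const) (use bound in auto)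
  then show ?thesis
    by (auto intro!: null_setsI)
qed

theorem corollary3p2:
  fixes q :: "nat \<Rightarrow> nat"
  assumes "basic_sequence q"
    and "infinite_in_limit q"
    and "one_convergent q"
  shows "RN1 q \<in> null_sets lebesgue"
proof -
  \<comment> \<open>The union runs over the countably many integer parts \<open>k\<close>.
    Completeness of Lebesgue measure then passes from this Borel null set to its subset
    \<open>RN1 q\<close>, measurability included.\<close>
  have "(\<Union>k. \<Inter>N. late_cells q k N) \<in> null_sets lborel"
    by (intro null_sets_UN late_cells_Inter_null assms)
  moreover have "RN1 q \<subseteq> (\<Union>k. \<Inter>N. late_cells q k N)"
    using RN1_subset_late_cells[OF assms(1)] by blast
  ultimately show ?thesis
    by (meson null_sets_completionI null_sets_completion_subset)
qed

end
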